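(* Let $C\subset\mathbb{R}^3$ be a smooth convex body. Then there exist arbitrarily small $r>0$ such that $$\max\{|X| : C\supset X+rB^3 \text{ is a packing}\}$$ is not attained by fcc or hexagonal close packing sets.
   Context: $B^3=\{x\in\mathbb{R}^3: |x|\le 1\}$ with $|\cdot|$ the Euclidean norm. A convex body is a compact convex subset of $\mathbb{R}^3$ with nonempty interior; it is smooth if it has a unique supporting hyperplane through each of its boundary points. For $r>0$ and $X\subset\mathbb{R}^3$, $X+rB^3$ is a (sphere) packing if distinct elements $x,x'\in X$ satisfy $|x-x'|\ge 2r$. $|X|$ is the cardinality of $X$. Hexagonal close packings: let $A=\mathbb{Z}a_1+\mathbb{Z}a_2$ with $a_1=(1,0,0)$, $a_2=(\tfrac12,\tfrac{\sqrt3}{2},0)$ (planar hexagonal lattice with minimum distance $1$), $s=\tfrac13(a_1+a_2)$ and $h=(0,0,\sqrt{2/3})$. A hexagonal close configuration (with minimum distance $1$) is a set $\bigcup_{k\in\mathbb{Z}}(A+\sigma_k s+k h)$, where $(\sigma_k)_{k\in\mathbb{Z}}$ is a sequence of integers with $\sigma_{k+1}-\sigma_k\in\{1,-1\}$ for all $k$, i.e. hexagonal layers stacked so that each new layer is placed in one of the two possible sets of holes of the previous one; the choice $\sigma_k=k$ gives the face centered cubic (fcc) lattice, so fcc is a special case. For spheres of radius $r$, an fcc or hexagonal close packing set is a set isometric to a subset of $2r\cdot H$ for some hexagonal close configuration $H$ (respectively for $H$ the fcc lattice). That the maximum is not attained by such sets means: no fcc or hexagonal close packing set $X$ (for radius $r$)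 satisfies both $X+rB^3\subset C$ and $|X|$ equal to the maximum. *)

theory Defs
  imports "HOL-Analysis.Analysis" "HOL-Library.Set_Algebras"
begin

definition convex_body :: "(real^3) set \<Rightarrow> bool" where
  "convex_body C \<longleftrightarrow> compact C \<and> convex C \<and> interior C \<noteq> {}"

definition supporting_hyperplane :: "(real^3) set \<Rightarrow> (real^3) set \<Rightarrow> bool" where
  "supporting_hyperplane C P \<longleftrightarrow>
    (\<exists>a b. a \<noteq> 0 \<and> P = {y. a \<bullet> y = b} \<and> C \<subseteq> {y. a \<bullet> y \<le> b} \<and> C \<inter> P \<noteq> {})"

definition smooth_convex_body :: "(real^3) set \<Rightarrow> bool" where
  "smooth_convex_body C \<longleftrightarrow>
    convex_body C \<and> (\<forall>x\<in>frontier C. \<exists>!P. supporting_hyperplane C P \<and> x \<in> P)"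

text \<open>The sum is the Minkowski sum from \<^theory>\<open>HOL-Library.Set_Algebras\<close>.\<close>

definition ball_arrangement :: "real \<Rightarrow> (real^3) set \<Rightarrow> (real^3) set" where
  "ball_arrangement r X = X + (*\<^sub>R) r ` cball 0 1"

definition is_packing :: "real \<Rightarrow> (real^3) set \<Rightarrow> bool" where
  "is_packing r X \<longleftrightarrow> (\<forall>x\<in>X. \<forall>y\<in>X. x \<noteq> y \<longrightarrow> norm (x - y) \<ge> 2 * r)"

definition packing_cards :: "(real^3) set \<Rightarrow> real \<Rightarrow> nat set" where
  "packing_cards C r = {card X |X. is_packing r X \<and> ball_arrangement r X \<subseteq> C}"

definition max_packing :: "(real^3) set \<Rightarrow> real \<Rightarrow> nat" where
  "max_packing C r = Max (packing_cards C r)"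

text \<open>
  For bounded \<open>C\<close> and \<open>r > 0\<close> the maximum is a genuine one, and no infinite set, whose
  \<^const>\<open>card\<close> would be \<open>0\<close>, is a competitor.
\<close>

lemma ball_arrangement_imp_subset: "ball_arrangement r X \<subseteq> C \<Longrightarrow> X \<subseteq> C"
  unfolding ball_arrangement_def set_plus_def by force

lemma packing_card_bound:
  assumes "bounded C" "r > 0"
  obtains N where
    "\<And>X. is_packing r X \<Longrightarrow> ball_arrangement r X \<subseteq> C \<Longrightarrow> finite X \<and> card X \<le> N"
proof -
  have "compact (closure C)" using assms(1) by (simp add: compact_closure)
  then obtain K where K: "finite K" "closure C \<subseteq> (\<Union>k\<in>K. ball k r)"
    using assms(2) unfolding compact_eq_totally_bounded by blast
  have "finite X \<and> card X \<le> card K"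
    if X: "is_packing r X" "ball_arrangement r X \<subseteq> C" for X
  proof -
    have "\<forall>x\<in>X. \<exists>k\<in>K. dist k x < r"
      using K(2) ball_arrangement_imp_subset[OF X(2)] closure_subset[of C] by fastforce
    then obtain g where g: "\<And>x. x \<in> X \<Longrightarrow> g x \<in> K \<and> dist (g x) x < r" by metis
    have "inj_on g X"
    proof (rule inj_onI, rule ccontr)
      fix x y assume xy: "x \<in> X" "y \<in> X" "g x = g y" "x \<noteq> y"
      have "dist x y \<le> dist (g x) x + dist (g y) y"
        using xy(3) by (metis dist_commute dist_triangle)
      also have "\<dots> < 2 * r" using g[OF xy(1)] g[OF xy(2)] by linarith
      finally show False using X(1) xy unfolding is_packing_def dist_norm by force
    qed
    then show ?thesis using g K(1)
      by (metis card_inj_on_le finite_subset image_subsetI finite_image_iff)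
  qed
  then show thesis using that by blast
qed

lemma packing_cards_finite_nonempty:
  assumes "bounded C" "r > 0"
  shows "finite (packing_cards C r)" "packing_cards C r \<noteq> {}"
proof -
  obtain N where "\<And>X. is_packing r X \<Longrightarrow> ball_arrangement r X \<subseteq> C \<Longrightarrow> finite X \<and> card X \<le> N"
    using packing_card_bound[OF assms] by blast
  then have "packing_cards C r \<subseteq> {..N}" unfolding packing_cards_def by auto
  then show "finite (packing_cards C r)" by (rule finite_subset) simp
  have "is_packing r {} \<and> ball_arrangement r {} \<subseteq> C"
    by (simp add: is_packing_def ball_arrangement_def set_plus_def)
  then show "packing_cards C r \<noteq> {}" unfolding packing_cards_def by blast
qed

definition hex_a1 :: "real^3" where "hex_a1 = vector [1, 0, 0]"
definition hex_a2 :: "real^3" where "hex_a2 = vector [1/2, sqrt 3 / 2, 0]"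
definition hex_s :: "real^3" where "hex_s = (1/3) *\<^sub>R (hex_a1 + hex_a2)"
definition hex_h :: "real^3" where "hex_h = vector [0, 0, sqrt (2/3)]"

definition hex_lattice :: "(real^3) set" where
  "hex_lattice = {of_int m *\<^sub>R hex_a1 + of_int n *\<^sub>R hex_a2 |m n. True}"

definition layer_stack :: "(int \<Rightarrow> int) \<Rightarrow> (real^3) set" where
  "layer_stack \<sigma> =
    (\<Union>k. (\<lambda>v. v + of_int (\<sigma> k) *\<^sub>R hex_s + of_int k *\<^sub>R hex_h) ` hex_lattice)"

definition hexagonal_close_configuration :: "(real^3) set \<Rightarrow> bool" where
  "hexagonal_close_configuration H \<longleftrightarrow>
    (\<exists>\<sigma>. (\<forall>k. \<sigma> (k + 1) - \<sigma> k \<in> {1, -1}) \<and> H = layer_stack \<sigma>)"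

definition fcc_lattice :: "(real^3) set" where
  "fcc_lattice = layer_stack (\<lambda>k. k)"

definition isometric_sets :: "(real^3) set \<Rightarrow> (real^3) set \<Rightarrow> bool" where
  "isometric_sets X Y \<longleftrightarrow>
    (\<exists>f. f ` X = Y \<and> (\<forall>x\<in>X. \<forall>y\<in>X. dist (f x) (f y) = dist x y))"

definition hexagonal_close_packing_set :: "real \<Rightarrow> (real^3) set \<Rightarrow> bool" where
  "hexagonal_close_packing_set r X \<longleftrightarrow>
    (\<exists>H Y. hexagonal_close_configuration H \<and> Y \<subseteq> (*\<^sub>R) (2 * r) ` H \<and> isometric_sets X Y)"

definition fcc_packing_set :: "real \<Rightarrow> (real^3) set \<Rightarrow> bool" where
  "fcc_packing_set r X \<longleftrightarrow>
    (\<exists>Y. Y \<subseteq> (*\<^sub>R) (2 * r) ` fcc_lattice \<and> isometric_sets X Y)"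

end

theory Submission
  imports Defs
begin

text \<open>
  For all small \<open>r\<close> every hexagonal close packing in \<open>C\<close> can be improved locally. Scale so that the
  minimum distance is \<open>1\<close> and the layers, at distance \<open>h = sqrt (2/3)\<close>, are horizontal. By smoothness,
  near every boundary point of \<open>C\<close> whose height is close to the maximal one the boundary is, on a fixed
  scale of a few dozen ball diameters, nearly a horizontal plane. All heights in a whole period
  \<open>h\<close> occur there, so one can choose a boundary point for which the centers may reach the height
  \<open>2.43\<close> above some layer. Since \<open>2 h < 2.43 < 3 h\<close>, at most two layers of the packing lie
  above that layer in a large box, about \<open>2.31\<close> balls per unit area. But \<open>1 + sqrt 2 < 2.43\<close>, so they can be
  replaced by three staggered square layers at heights \<open>1\<close>, \<open>1 + 1 / sqrt 2\<close>, \<open>1 + sqrt 2\<close>, which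
  contain \<open>3\<close> balls per unit area; the loss along the sides of the box is of lower order.
\<close>

section \<open>Boundary of a smooth convex body\<close>

lemma support_point_in_frontier:
  fixes C :: "(real^3) set"
  assumes "u \<noteq> 0" "q \<in> C" "\<And>x. x \<in> C \<Longrightarrow> u \<bullet> x \<le> u \<bullet> q"
  shows "q \<in> frontier C"
proof -
  have "q \<notin> interior C"
  proof
    assume "q \<in> interior C"
    then obtain e where e: "e > 0" "cball q e \<subseteq> C" using mem_interior_cball by blast
    have "q + (e / norm u) *\<^sub>R u \<in> C"
      using e assms(1) by (intro subsetD[OF e(2)]) (simp add: dist_norm)
    from assms(3)[OF this] have "e / norm u * (u \<bullet> u) \<le> 0" by (simp add: inner_add_right)
    moreover have "0 < u \<bullet> u" using assms(1) by simp
    ultimately show False using e(1) assms(1) by (simp add: divide_le_0_iff mult_le_0_iff)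
  qed
  then show ?thesis using assms(2) closure_subset unfolding frontier_def by blast
qed

text \<open>Smoothness identifies the two supporting hyperplanes only as point sets, so the unit
  normals agree up to sign. Opposite signs would squeeze \<open>C\<close> into that hyperplane,
  against its nonempty interior.\<close>

lemma smooth_normal_unique:
  assumes C: "smooth_convex_body C" and q: "q \<in> C" and n: "norm u = 1" "norm m = 1"
    and u: "\<And>x. x \<in> C \<Longrightarrow> u \<bullet> x \<le> u \<bullet> q" and m: "\<And>x. x \<in> C \<Longrightarrow> m \<bullet> x \<le> m \<bullet> q"
  shows "u = m"
proof -
  have u0: "u \<noteq> 0" "m \<noteq> 0" using n by auto
  have fr: "q \<in> frontier C" by (rule support_point_in_frontier[OF u0(1) q u])
  define P where "P a = {y. a \<bullet> y = a \<bullet> q}" for a :: "real^3"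
  have "supporting_hyperplane C (P u) \<and> q \<in> P u" "supporting_hyperplane C (P m) \<and> q \<in> P m"
    unfolding supporting_hyperplane_def P_def using u0 u m q by blast+
  then have PP: "P u = P m" using C fr unfolding smooth_convex_body_def by blast
  \<comment> \<open>\<open>w\<close> is the part of \<open>u\<close> orthogonal to \<open>m\<close>.
    Moving from \<open>q\<close> by \<open>w\<close> stays in the common hyperplane, so
    \<open>w\<close> is orthogonal to both normals and vanishes.\<close>
  define w where "w = u - (m \<bullet> u) *\<^sub>R m"
  have mm: "m \<bullet> m = 1" "u \<bullet> u = 1" using n by (simp_all add: norm_eq_1)
  have "q + w \<in> P m" by (simp add: P_def w_def inner_add_right inner_diff_right mm)
  then have "q + w \<in> P u" using PP by simp
  then have "u \<bullet> w = 0" by (simp add: P_def inner_add_right)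
  moreover have "m \<bullet> w = 0" by (simp add: w_def inner_diff_right mm)
  ultimately have "w \<bullet> w = 0" by (simp add: w_def inner_diff_left)
  then have um: "u = (m \<bullet> u) *\<^sub>R m" by (simp add: w_def)
  then have "norm u = \<bar>m \<bullet> u\<bar> * norm m" by (metis norm_scaleR)
  then have "m \<bullet> u = 1 \<or> m \<bullet> u = -1" using n by auto
  then show ?thesis
  proof
    assume "m \<bullet> u = -1"
    then have um': "u = - m" using um by simp
    have "m \<bullet> x = m \<bullet> q" if "x \<in> C" for x
      using u[OF that] m[OF that] um' by simp
    then have "interior C \<subseteq> {x. m \<bullet> x = m \<bullet> q}" using interior_subset by blast
    then have "interior C \<subseteq> interior {x. m \<bullet> x = m \<bullet> q}" by (simp add: interior_maximal)
    then have "interior C = {}" using u0(2) by (simp add: interior_hyperplane)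
    then show ?thesis using C unfolding smooth_convex_body_def convex_body_def by blast
  qed (use um in simp)
qed

text \<open>Compactness turns uniqueness of the normal into a statement uniform in point and direction.\<close>

lemma almost_normals_close:
  assumes C: "smooth_convex_body C" and e: "\<epsilon> > 0"
  obtains \<tau> where "\<tau> > 0"
    "\<And>q u m. q \<in> C \<Longrightarrow> norm u = 1 \<Longrightarrow> norm m = 1 \<Longrightarrow> (\<And>x. x \<in> C \<Longrightarrow> u \<bullet> x \<le> u \<bullet> q + \<tau>) \<Longrightarrow>
      (\<And>x. x \<in> C \<Longrightarrow> m \<bullet> x \<le> m \<bullet> q + \<tau>) \<Longrightarrow> norm (u - m) < \<epsilon>"
proof -
  have cpt: "compact C" using C unfolding smooth_convex_body_def convex_body_def by blast
  let ?S = "C \<times> sphere (0::real^3) 1 \<times> sphere (0::real^3) 1"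
  \<comment> \<open>\<open>F n\<close> collects the counterexamples \<open>(q, u, m)\<close> for the
    tolerance \<open>1 / Suc n\<close>. These sets are compact and nested; if none were empty, a
    common element would be a point with two distinct exact normals.\<close>
  define F where "F n = ?S \<inter> {z. \<epsilon> \<le> norm (fst (snd z) - snd (snd z)) \<and>
     (\<forall>x\<in>C. fst (snd z) \<bullet> x \<le> fst (snd z) \<bullet> fst z + 1 / real (Suc n)) \<and>
     (\<forall>x\<in>C. snd (snd z) \<bullet> x \<le> snd (snd z) \<bullet> fst z + 1 / real (Suc n))}" for n
  have cF: "compact (F n)" for n
    unfolding F_def
  proof (rule compact_Int_closed)
    show "compact ?S" by (intro compact_Times cpt compact_sphere)
    show "closed {z::(real^3)\<times>(real^3)\<times>(real^3). \<epsilon> \<le> norm (fst (snd z) - snd (snd z)) \<and>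
     (\<forall>x\<in>C. fst (snd z) \<bullet> x \<le> fst (snd z) \<bullet> fst z + 1 / real (Suc n)) \<and>
     (\<forall>x\<in>C. snd (snd z) \<bullet> x \<le> snd (snd z) \<bullet> fst z + 1 / real (Suc n))}"
    proof (intro closed_Collect_conj)
      have c: "closed {z. \<forall>x\<in>C. f z \<bullet> x \<le> f z \<bullet> fst z + 1 / real (Suc n)}"
        if "continuous_on UNIV f" for f :: "(real^3)\<times>(real^3)\<times>(real^3) \<Rightarrow> real^3"
      proof -
        have "{z. \<forall>x\<in>C. f z \<bullet> x \<le> f z \<bullet> fst z + 1 / real (Suc n)}
          = (\<Inter>x\<in>C. {z. f z \<bullet> x \<le> f z \<bullet> fst z + 1 / real (Suc n)})" by blast
        moreover have "closed {z. f z \<bullet> x \<le> f z \<bullet> fst z + 1 / real (Suc n)}" for x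
          by (rule closed_Collect_le) (intro continuous_intros that)+
        ultimately show ?thesis by (simp add: closed_INT)
      qed
      show "closed {z::(real^3)\<times>(real^3)\<times>(real^3). \<forall>x\<in>C. fst (snd z) \<bullet> x \<le> fst (snd z) \<bullet> fst z + 1 / real (Suc n)}"
        by (rule c) (intro continuous_intros)
      show "closed {z::(real^3)\<times>(real^3)\<times>(real^3). \<forall>x\<in>C. snd (snd z) \<bullet> x \<le> snd (snd z) \<bullet> fst z + 1 / real (Suc n)}"
        by (rule c) (intro continuous_intros)
      show "closed {z::(real^3)\<times>(real^3)\<times>(real^3). \<epsilon> \<le> norm (fst (snd z) - snd (snd z))}"
        by (rule closed_Collect_le) (intro continuous_intros)+
    qed
  qed
  have dec: "F n \<subseteq> F m" if "m \<le> n" for m n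
  proof -
    have le: "1 / real (Suc n) \<le> 1 / real (Suc m)" using that by (simp add: frac_le)
    show ?thesis unfolding F_def using le by fastforce
  qed
  have "\<exists>n. F n = {}"
  proof (rule ccontr)
    assume "\<nexists>n. F n = {}"
    then have "\<Inter>(range F) \<noteq> {}" by (intro compact_nest cF dec) simp_all
    then obtain z where z: "z \<in> \<Inter>(range F)" by (meson ex_in_conv)
    obtain q u m where "z = (q, u, m)" by (rule prod_cases3)
    then have F: "(q, u, m) \<in> F n" for n using z by simp
    have b: "a \<le> b" if "\<And>n. a \<le> b + 1 / real (Suc n)" for a b :: real
    proof (rule field_le_epsilon)
      fix e :: real assume "e > 0"
      then obtain n where "1 / real (Suc n) < e" using nat_approx_posE by blast
      then show "a \<le> b + e" using that[of n] by linarith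
    qed
    have "u \<bullet> x \<le> u \<bullet> q" "m \<bullet> x \<le> m \<bullet> q" if "x \<in> C" for x
      by (rule b, use F that in \<open>simp add: F_def\<close>)+
    moreover have "q \<in> C" "norm u = 1" "norm m = 1" using F[of 0] unfolding F_def by auto
    ultimately have "u = m" using smooth_normal_unique[OF C] by blast
    then show False using F[of 0] e unfolding F_def by simp
  qed
  then obtain n where n: "F n = {}" by blast
  show thesis
  proof (rule that)
    show "1 / real (Suc n) > 0" by simp
    fix q u m :: "real^3"
    assume "q \<in> C" "norm u = 1" "norm m = 1" "\<And>x. x \<in> C \<Longrightarrow> u \<bullet> x \<le> u \<bullet> q + 1 / real (Suc n)"
      "\<And>x. x \<in> C \<Longrightarrow> m \<bullet> x \<le> m \<bullet> q + 1 / real (Suc n)"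
    moreover have "(q, u, m) \<notin> F n" using n by blast
    ultimately show "norm (u - m) < \<epsilon>" unfolding F_def by auto
  qed
qed

lemma unit_normal_outside:
  fixes C :: "(real^3) set"
  assumes "compact C" "convex C" "z \<notin> C"
  obtains m where "norm m = 1" "\<And>x. x \<in> C \<Longrightarrow> m \<bullet> x \<le> m \<bullet> z"
proof -
  obtain a b where ab: "a \<bullet> z < b" "\<forall>x\<in>C. a \<bullet> x > b"
    using separating_hyperplane_closed_point[OF assms(2) compact_imp_closed[OF assms(1)] assms(3)]
    by blast
  show thesis
  proof (cases "C = {}")
    case True
    then show thesis using that[of "axis 1 1"] by simp
  next
    case False
    then have "a \<noteq> 0" using ab by force
    then show thesis
      using ab by (intro that[of "(- 1 / norm a) *\<^sub>R a"]) (force simp: divide_right_mono)+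
  qed
qed

lemma unit_normal_frontier:
  fixes C :: "(real^3) set"
  assumes "compact C" "convex C" "q \<in> frontier C"
  obtains m where "norm m = 1" "\<And>x. x \<in> C \<Longrightarrow> m \<bullet> x \<le> m \<bullet> q"
proof -
  have "closure C = C" using assms(1) by (simp add: compact_imp_closed)
  then have qC: "q \<in> C" "q \<notin> interior C" using assms(3) unfolding frontier_def by auto
  have "\<exists>a. a \<noteq> 0 \<and> (\<forall>x\<in>C. a \<bullet> q \<le> a \<bullet> x)"
  proof (cases "interior C = {}")
    case True
    then obtain a b where ab: "a \<noteq> 0" "C \<subseteq> {x. a \<bullet> x = b}"
      using empty_interior_subset_hyperplane[OF assms(2)] by metis
    then have "\<forall>x\<in>C. a \<bullet> q = a \<bullet> x" using qC(1) by blast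
    then have "\<forall>x\<in>C. a \<bullet> q \<le> a \<bullet> x" by simp
    then show ?thesis using ab(1) by blast
  next
    case False
    then have "q \<notin> rel_interior C" using qC(2) by (simp add: rel_interior_nonempty_interior)
    then show ?thesis using supporting_hyperplane_rel_boundary[OF assms(2) qC(1)] by metis
  qed
  then obtain a where a: "a \<noteq> 0" "\<And>x. x \<in> C \<Longrightarrow> a \<bullet> q \<le> a \<bullet> x" by blast
  show thesis
    using a by (intro that[of "(- 1 / norm a) *\<^sub>R a"]) (auto simp: divide_right_mono)
qed

text \<open>The direction \<open>u\<close> is an almost normal at every point \<open>q\<close> of
  the high cap. A normal \<open>m\<close> separating \<open>C\<close> from a missing point
  \<open>q + v\<close>, or supporting \<open>C\<close> at \<open>q\<close>, is one as well, so
  \<open>u\<close> and \<open>m\<close> differ by less than \<open>\<epsilon>\<close>. Hence near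
  \<open>q\<close> the body contains a wide downward cone and stays below a flat upward one.\<close>

lemma smooth_cap_flat:
  assumes C: "smooth_convex_body C" and e: "\<epsilon> > 0"
  obtains \<tau> where "\<tau> > 0"
    "\<And>q u v. q \<in> C \<Longrightarrow> norm u = 1 \<Longrightarrow> (\<And>x. x \<in> C \<Longrightarrow> u \<bullet> x \<le> u \<bullet> q + \<tau>) \<Longrightarrow>
       norm v \<le> \<tau> \<Longrightarrow> u \<bullet> v \<le> - \<epsilon> * norm v \<Longrightarrow> q + v \<in> C"
    "\<And>q u v. q \<in> frontier C \<Longrightarrow> norm u = 1 \<Longrightarrow> (\<And>x. x \<in> C \<Longrightarrow> u \<bullet> x \<le> u \<bullet> q + \<tau>) \<Longrightarrow>
       q + v \<in> C \<Longrightarrow> u \<bullet> v \<le> \<epsilon> * norm v"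
proof -
  have cpt: "compact C" "convex C" using C unfolding smooth_convex_body_def convex_body_def by auto
  obtain \<tau> where \<tau>: "\<tau> > 0"
    "\<And>q u m. q \<in> C \<Longrightarrow> norm u = 1 \<Longrightarrow> norm m = 1 \<Longrightarrow> (\<And>x. x \<in> C \<Longrightarrow> u \<bullet> x \<le> u \<bullet> q + \<tau>) \<Longrightarrow>
      (\<And>x. x \<in> C \<Longrightarrow> m \<bullet> x \<le> m \<bullet> q + \<tau>) \<Longrightarrow> norm (u - m) < \<epsilon>"
    using almost_normals_close[OF C e] by metis
  show thesis
  proof (rule that[OF \<tau>(1)])
    fix q u v :: "real^3"
    assume q: "q \<in> C" and u: "norm u = 1" "\<And>x. x \<in> C \<Longrightarrow> u \<bullet> x \<le> u \<bullet> q + \<tau>"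
      and v: "norm v \<le> \<tau>" "u \<bullet> v \<le> - \<epsilon> * norm v"
    show "q + v \<in> C"
    proof (rule ccontr)
      assume nin: "q + v \<notin> C"
      obtain m where m: "norm m = 1" "\<And>x. x \<in> C \<Longrightarrow> m \<bullet> x \<le> m \<bullet> (q + v)"
        by (rule unit_normal_outside[OF cpt nin]) blast
      \<comment> \<open>Replacing \<open>q + v\<close> by \<open>q\<close> costs at most
        \<open>\<tau>\<close>, so \<open>m\<close> is an almost normal at \<open>q\<close>
        itself.\<close>
      have "m \<bullet> v \<le> \<tau>" using norm_cauchy_schwarz[of m v] m(1) v(1) by simp
      then have "norm (u - m) < \<epsilon>"
        using m(2) by (intro \<tau>(2)[OF q u(1) m(1) u(2)]) (force simp: inner_add_right)+
      moreover have "0 < norm v" using nin q by force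
      ultimately have "norm (u - m) * norm v < \<epsilon> * norm v" by simp
      moreover have "(m - u) \<bullet> v \<le> norm (u - m) * norm v"
        using norm_cauchy_schwarz[of "m - u" v] by (simp add: norm_minus_commute)
      moreover have "0 \<le> m \<bullet> v" using m(2)[OF q] by (simp add: inner_add_right)
      ultimately show False using v(2) by (simp add: inner_diff_left)
    qed
  next
    fix q u v :: "real^3"
    assume q: "q \<in> frontier C" and u: "norm u = 1" "\<And>x. x \<in> C \<Longrightarrow> u \<bullet> x \<le> u \<bullet> q + \<tau>"
      and v: "q + v \<in> C"
    have qC: "q \<in> C" using q cpt(1) by (simp add: frontier_def compact_imp_closed)
    obtain m where m: "norm m = 1" "\<And>x. x \<in> C \<Longrightarrow> m \<bullet> x \<le> m \<bullet> q"
      using unit_normal_frontier[OF cpt q] by metis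
    have "norm (u - m) < \<epsilon>"
      using m(2) \<tau>(1) by (intro \<tau>(2)[OF qC u(1) m(1) u(2)]) force+
    then have "norm (u - m) * norm v \<le> \<epsilon> * norm v" by (simp add: mult_right_mono)
    moreover have "(u - m) \<bullet> v \<le> norm (u - m) * norm v" by (rule norm_cauchy_schwarz)
    moreover have "m \<bullet> v \<le> 0" using m(2)[OF v] by (simp add: inner_add_right)
    ultimately show "u \<bullet> v \<le> \<epsilon> * norm v" by (simp add: inner_diff_left)
  qed
qed

text \<open>The intermediate value theorem gives a point of \<open>C\<close> at height
  \<open>t\<close>; leaving \<open>C\<close> from there orthogonally to \<open>u\<close> crosses the
  frontier without changing the height.\<close>

lemma frontier_point_at_height:
  fixes C :: "(real^3) set"
  assumes "compact C" "convex C" "a \<in> C" "b \<in> C" "u \<bullet> a \<le> t" "t \<le> u \<bullet> b"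
  obtains q where "q \<in> frontier C" "u \<bullet> q = t"
proof -
  have "\<exists>z\<in>C. u \<bullet> z = t"
  proof -
    have "is_interval ((\<bullet>) u ` C)"
      unfolding is_interval_connected_1
      by (intro connected_continuous_image continuous_intros convex_connected assms)
    then have "t \<in> (\<bullet>) u ` C" using assms(3-6) unfolding is_interval_1 by blast
    then show ?thesis by force
  qed
  then obtain z where z: "z \<in> C" "u \<bullet> z = t" by blast
  obtain w where w: "w \<noteq> 0" "u \<bullet> w = 0"
    using orthogonal_to_vector_exists[of u] by (auto simp: orthogonal_def)
  obtain B where B: "B > 0" "\<And>x. x \<in> C \<Longrightarrow> norm x \<le> B"
    using compact_imp_bounded[OF assms(1)] bounded_pos by metis
  \<comment> \<open>The displacement has length \<open>norm z + B + 1\<close>, which carries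
    \<open>y\<close> out of the ball of radius \<open>B\<close> containing \<open>C\<close>.\<close>
  define y where "y = z + ((norm z + B + 1) / norm w) *\<^sub>R w"
  have "norm (((norm z + B + 1) / norm w) *\<^sub>R w) = norm z + B + 1" using w(1) B(1) by simp
  then have "norm y \<ge> B + 1"
    using norm_triangle_ineq4[of y z] unfolding y_def by simp
  then have "y \<notin> C" using B(2) by force
  then have "closed_segment z y \<inter> frontier C \<noteq> {}"
    using z(1) by (intro connected_Int_frontier) auto
  then obtain q where q: "q \<in> closed_segment z y" "q \<in> frontier C" by blast
  then obtain s where "q = (1 - s) *\<^sub>R z + s *\<^sub>R y" unfolding closed_segment_def by blast
  then have "u \<bullet> q = t" using z(2) w(2)
    by (simp add: y_def inner_add_right algebra_simps)
  with q(2) show thesis by (rule that)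
qed

section \<open>Exchanging hexagonal layers for square layers\<close>

lemma norm_sq_3: "(norm (v :: real^3))\<^sup>2 = (v$1)\<^sup>2 + (v$2)\<^sup>2 + (v$3)\<^sup>2"
  unfolding power2_norm_eq_inner inner_vec_def by (simp add: sum_3 power2_eq_square)

text \<open>The form is the squared length of \<open>m\<close> times \<open>hex_a1\<close> plus
  \<open>n\<close> times \<open>hex_a2\<close>, so this is the minimum distance within one layer.
  Doubled, it is a sum of three squares.\<close>

lemma hex_form_ge_1:
  fixes m n :: int
  assumes "m \<noteq> 0 \<or> n \<noteq> 0"
  shows "m^2 + m * n + n^2 \<ge> 1"
proof -
  have "m^2 + n^2 > 0" using assms by (simp add: sum_power2_gt_zero_iff)
  moreover have "2 * (m^2 + m * n + n^2) = m^2 + n^2 + (m + n)^2" by (simp add: power2_eq_square algebra_simps)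
  moreover have "(m + n)^2 \<ge> 0" by simp
  ultimately have "2 * (m^2 + m * n + n^2) > 0" by (metis add_pos_nonneg)
  then show ?thesis by simp
qed

text \<open>This serves neighbouring layers, whose shifts differ by \<open>d\<close>: there the
  squared distance of two points is this expression plus \<open>1\<close>.\<close>

lemma hex_form_shifted_nonneg:
  fixes m n d :: int
  assumes "d = 1 \<or> d = -1"
  shows "m^2 + m * n + n^2 + d * (m + n) \<ge> 0"
proof -
  have dd: "d * d = 1" using assms by auto
  have eq: "2 * (m^2 + m * n + n^2 + d * (m + n)) = m^2 + n^2 + (m + n + d)^2 - 1"
    using dd by (simp add: power2_eq_square algebra_simps)
  show ?thesis
  proof (cases "m = 0 \<and> n = 0")
    case False
    then have "m^2 + n^2 > 0" by (simp add: sum_power2_gt_zero_iff)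
    then have "2 * (m^2 + m * n + n^2 + d * (m + n)) \<ge> 0"
      using zero_le_power2[of "m + n + d"] unfolding eq by linarith
    then show ?thesis by simp
  qed simp
qed

text \<open>Explicit coordinates of a point of layer \<open>k\<close>. The shift \<open>s\<close> is
  an independent parameter, so that one distance formula covers every stacking sequence.\<close>

definition hex_point :: "int \<Rightarrow> int \<Rightarrow> int \<Rightarrow> int \<Rightarrow> real^3" where
  "hex_point s k m n = vector [m + n / 2 + s / 2, (n / 2 + s / 6) * sqrt 3, k * sqrt (2/3)]"

lemma hex_point_nth [simp]:
  "hex_point s k m n $ 1 = m + n / 2 + s / 2"
  "hex_point s k m n $ 2 = (n / 2 + s / 6) * sqrt 3"
  "hex_point s k m n $ 3 = k * sqrt (2/3)"
  by (simp_all add: hex_point_def)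

lemma layer_stack_iff: "y \<in> layer_stack \<sigma> \<longleftrightarrow> (\<exists>k m n. y = hex_point (\<sigma> k) k m n)"
proof -
  have "of_int m *\<^sub>R hex_a1 + of_int n *\<^sub>R hex_a2 + of_int (\<sigma> k) *\<^sub>R hex_s + of_int k *\<^sub>R hex_h
    = hex_point (\<sigma> k) k m n" for k m n
    by (simp add: vec_eq_iff forall_3 hex_a1_def hex_a2_def hex_s_def hex_h_def algebra_simps)
  then show ?thesis unfolding layer_stack_def hex_lattice_def by (auto simp: image_iff) metis+
qed

text \<open>The fractions come from the squared lengths \<open>1/3\<close> of \<open>hex_s\<close>
  and \<open>2/3\<close> of \<open>hex_h\<close>. Since \<open>hex_s\<close> has scalar product
  \<open>1/2\<close> with both \<open>hex_a1\<close> and \<open>hex_a2\<close>, all other terms are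
  integers.\<close>

lemma hex_point_dist_sq:
  "(norm (hex_point s k m n - hex_point s' k' m' n'))\<^sup>2 =
    of_int ((m - m')^2 + (m - m') * (n - n') + (n - n')^2 + (s - s') * ((m - m') + (n - n')))
     + (of_int ((s - s')^2) + 2 * of_int ((k - k')^2)) / 3"
proof -
  have "((of_int n / 2 + of_int s / 6) * sqrt 3 - (of_int n' / 2 + of_int s' / 6) * sqrt 3)\<^sup>2
     = 3 * ((of_int n / 2 + of_int s / 6) - (of_int n' / 2 + of_int s' / 6 :: real))\<^sup>2"
    "(of_int k * sqrt (2/3) - of_int k' * sqrt (2/3))\<^sup>2 = 2 / 3 * (of_int k - of_int k' :: real)\<^sup>2"
    by (simp_all add: left_diff_distrib[symmetric] power_mult_distrib)
  then show ?thesis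
    by (simp add: norm_sq_3) (simp add: power2_eq_square field_simps)
qed

lemma hexagonal_close_configuration_separated:
  assumes H: "hexagonal_close_configuration H" and y: "y \<in> H" "y' \<in> H" "y \<noteq> y'"
  shows "norm (y - y') \<ge> 1"
proof -
  obtain \<sigma> where \<sigma>: "\<And>k. \<sigma> (k + 1) - \<sigma> k = 1 \<or> \<sigma> (k + 1) - \<sigma> k = -1" "H = layer_stack \<sigma>"
    using H unfolding hexagonal_close_configuration_def by auto
  obtain k m n k' m' n' where e: "y = hex_point (\<sigma> k) k m n" "y' = hex_point (\<sigma> k') k' m' n'"
    using y \<sigma>(2) layer_stack_iff by metis
  define d where "d = \<sigma> k - \<sigma> k'"
  define M where "M = m - m'"
  define N where "N = n - n'"
  have D: "(norm (y - y'))\<^sup>2 = of_int (M^2 + M * N + N^2 + d * (M + N))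
     + (of_int (d^2) + 2 * of_int ((k - k')^2)) / 3"
    unfolding e M_def N_def d_def by (rule hex_point_dist_sq)
  have "(norm (y - y'))\<^sup>2 \<ge> 1"
  proof -
    consider "k = k'" | "k - k' = 1 \<or> k - k' = -1" | "\<bar>k - k'\<bar> \<ge> 2" by linarith
    then show ?thesis
    proof cases
      case 1
      then have "M \<noteq> 0 \<or> N \<noteq> 0" using y(3) e unfolding M_def N_def by auto
      from hex_form_ge_1[OF this] show ?thesis
        unfolding D by (simp add: 1 d_def del: of_int_add of_int_mult of_int_power)
    next
      case 2
      then have d: "d = 1 \<or> d = -1"
        using \<sigma>(1)[of k] \<sigma>(1)[of k'] unfolding d_def by (smt (verit) diff_add_cancel)
      then have "d^2 = 1" "(k - k')^2 = 1" using 2 by auto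
      with hex_form_shifted_nonneg[OF d, of M N] show ?thesis
        unfolding D by (simp del: of_int_add of_int_mult of_int_power)
    next
      \<comment> \<open>Two or more layers apart, the vertical part alone is at least
        \<open>8/3\<close>.\<close>
      case 3
      have "2^2 \<le> \<bar>k - k'\<bar>^2" by (rule power_mono[OF 3]) simp
      then have "4 \<le> (k - k')^2" by simp
      then have "4 \<le> real_of_int ((k - k')^2)" by linarith
      moreover have "(norm (y - y'))\<^sup>2 = (y$1 - y'$1)^2 + (y$2 - y'$2)^2 + 2 / 3 * of_int ((k - k')^2)"
        unfolding norm_sq_3 by (simp add: e left_diff_distrib[symmetric] power_mult_distrib)
      moreover have "(y$1 - y'$1)^2 \<ge> 0" "(y$2 - y'$2)^2 \<ge> 0" by simp_all
      ultimately show ?thesis by linarith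
    qed
  qed
  then show ?thesis by (simp add: power2_nonneg_ge_1_iff)
qed

text \<open>Rows are \<open>sqrt 3 / 2\<close> apart, so at most \<open>49\<close> of them meet an
  open strip of width \<open>42\<close>, and each has at most \<open>42\<close> points at unit
  spacing in it; \<open>42 * 49 = 2058\<close>.\<close>

lemma card_hex_layer_box:
  fixes a b :: real and s k :: int
  defines "B \<equiv> {y. (\<exists>m n. y = hex_point s k m n) \<and> \<bar>y$1 - a\<bar> < 21 \<and> \<bar>y$2 - b\<bar> < 21}"
  shows "finite B" "card B \<le> 2058"
proof -
  \<comment> \<open>\<open>c\<close> is the strict lower bound on the row index \<open>n\<close>
    that \<open>b - 21 < y$2\<close> imposes. In \<open>\<phi>\<close>, the index \<open>i\<close>
    counts the points of row \<open>n\<close> from the left end of the box.\<close>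
  define c where "c = 2 * (b - 21) / sqrt 3 - s / 3"
  define I where "I = {1..42::int} \<times> {\<lfloor>c\<rfloor> + 1..\<lfloor>c\<rfloor> + 49}"
  define \<phi> where "\<phi> = (\<lambda>(i, n). hex_point s k (\<lfloor>a - 21 - n / 2 - s / 2\<rfloor> + i) n)"
  have sub: "B \<subseteq> \<phi> ` I"
  proof
    fix y assume "y \<in> B"
    then obtain m n where y: "y = hex_point s k m n" "\<bar>y$1 - a\<bar> < 21" "\<bar>y$2 - b\<bar> < 21"
      unfolding B_def by blast
    define i where "i = m - \<lfloor>a - 21 - n / 2 - s / 2\<rfloor>"
    have "i \<in> {1..42}" using y(2) unfolding y(1) i_def by simp linarith
    moreover have "n \<in> {\<lfloor>c\<rfloor> + 1..\<lfloor>c\<rfloor> + 49}"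
    proof -
      have s3: "sqrt 3 > (0::real)" by simp
      \<comment> \<open>The bound \<open>12 / 7\<close> is chosen because
        \<open>84 / (12 / 7) = 49\<close>.\<close>
      have "12 / 7 < sqrt (3::real)" by (rule real_less_rsqrt) (simp add: power2_eq_square)
      then have 49: "84 / sqrt 3 < (49::real)" by (simp add: field_simps)
      have yy: "b - 21 < (n / 2 + s / 6) * sqrt 3" "(n / 2 + s / 6) * sqrt 3 < b + 21"
        using y(3) unfolding y(1) by (simp_all add: abs_less_iff)
      have lin: "c < n \<and> n < c + 49"
        if "l < n / 2 + s / 6" "n / 2 + s / 6 < u" "2 * l = c + s / 3" "2 * u = c + s / 3 + w" "w < 49"
        for l u w :: real
        using that by linarith
      have "2 * ((b + 21) / t) = 2 * (b - 21) / t + 84 / t" for t :: real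
        by (simp flip: add_divide_distrib)
      then have 2: "2 * ((b + 21) / sqrt 3) = c + s / 3 + 84 / sqrt 3" by (simp add: c_def)
      have 1: "2 * ((b - 21) / sqrt 3) = c + s / 3" by (simp add: c_def)
      have "(b - 21) / sqrt 3 < n / 2 + s / 6" "n / 2 + s / 6 < (b + 21) / sqrt 3"
        using yy by (simp_all only: pos_divide_less_eq[OF s3] pos_less_divide_eq[OF s3])
      from lin[OF this 1 2 49] have "c < n" "n < c + 49" by simp_all
      then show ?thesis by simp linarith
    qed
    moreover have "y = \<phi> (i, n)" by (simp add: \<phi>_def i_def y(1))
    ultimately show "y \<in> \<phi> ` I" unfolding I_def by blast
  qed
  have fI: "finite I" "card I = 2058" by (simp_all add: I_def card_cartesian_product)
  show "finite (B)" using sub fI(1) finite_surj by blast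
  show "card (B) \<le> 2058"
    using surj_card_le[OF fI(1) sub] fI(2) by simp
qed

text \<open>The shift by one half in the middle layer puts its points over the holes of the other two.\<close>

definition square_point :: "real^3 \<Rightarrow> real \<Rightarrow> int \<times> int \<times> int \<Rightarrow> real^3" where
  "square_point q z = (\<lambda>(i, j, a). let e = (if a = 1 then 1/2 else 0) in
     vector [q$1 - 20 + i + e, q$2 - 20 + j + e, z + 1 + a * sqrt (1/2)])"

text \<open>Within a layer the offset is a nonzero integer vector. Adjacent layers give at least
  \<open>1/4 + 1/4 + 1/2 = 1\<close>, because an integer plus or minus one half has absolute value
  at least \<open>1/2\<close>. The outer layers are \<open>sqrt 2\<close> apart vertically.\<close>

lemma square_point_separated:
  assumes "p \<noteq> p'" "snd (snd p) \<in> {0..2}" "snd (snd p') \<in> {0..2}"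
  shows "norm (square_point q z p - square_point q z p') \<ge> 1"
proof -
  obtain i j a i' j' a' where p: "p = (i, j, a)" "p' = (i', j', a')"
    using prod_cases3 by metis
  define e :: "int \<Rightarrow> real" where "e a = (if a = 1 then 1/2 else 0)" for a
  let ?x = "of_int (i - i') + (e a - e a') :: real"
  let ?y = "of_int (j - j') + (e a - e a') :: real"
  have D: "(norm (square_point q z p - square_point q z p'))\<^sup>2 = ?x^2 + ?y^2 + of_int ((a - a')^2) / 2"
    unfolding norm_sq_3
    by (simp add: p square_point_def Let_def e_def[symmetric] left_diff_distrib[symmetric]
        power_mult_distrib) (simp add: algebra_simps)
  have half: "(of_int l + c)^2 \<ge> 1/4" if "c = 1/2 \<or> c = -1/2" for l :: int and c :: real
  proof -
    have "\<bar>of_int l + c\<bar> \<ge> 1/2"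
    proof -
      consider "l \<ge> 1" | "l = 0" | "l \<le> -1" by linarith
      then show ?thesis
      proof cases
        case 1
        then have "real_of_int l \<ge> 1" by simp
        then show ?thesis using that by auto
      next
        case 3
        then have "real_of_int l \<le> -1" by linarith
        then show ?thesis using that by auto
      qed (use that in auto)
    qed
    then have "(1/2)^2 \<le> \<bar>of_int l + c\<bar>^2" by (rule power_mono) simp
    then show ?thesis by (simp add: power2_eq_square)
  qed
  have a: "0 \<le> a" "a \<le> 2" "0 \<le> a'" "a' \<le> 2" using assms p by auto
  consider "a = a'" | "\<bar>a - a'\<bar> = 1" | "\<bar>a - a'\<bar> = 2" using a by linarith
  then have "(norm (square_point q z p - square_point q z p'))\<^sup>2 \<ge> 1"
  proof cases
    case 1
    then have "i - i' \<noteq> 0 \<or> j - j' \<noteq> 0" using assms(1) p by auto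
    then have "(i - i')^2 + (j - j')^2 > 0" by (simp add: sum_power2_gt_zero_iff)
    then have "real_of_int ((i - i')^2 + (j - j')^2) \<ge> 1" by linarith
    then show ?thesis unfolding D using 1 by simp
  next
    case 2
    then have "e a - e a' = 1/2 \<or> e a - e a' = -1/2" using a unfolding e_def by auto
    from half[OF this, of "i - i'"] half[OF this, of "j - j'"]
    moreover have "(a - a')^2 = 1" using 2 by (metis power2_abs power_one)
    ultimately show ?thesis unfolding D by simp
  next
    case 3
    then have "\<bar>a - a'\<bar>^2 = 4" by simp
    then have "of_int ((a - a')^2) / 2 = (2::real)" by simp
    then show ?thesis unfolding D using zero_le_power2[of ?x] zero_le_power2[of ?y] by linarith
  qed
  then show ?thesis by (simp add: power2_nonneg_ge_1_iff)
qed

lemma replace_two_hex_layers: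
  fixes Y :: "(real^3) set" and q :: "real^3" and k :: int
  assumes H: "hexagonal_close_configuration H" and Y: "finite Y" "Y \<subseteq> H"
    and top: "\<forall>y\<in>Y. \<bar>y$1 - q$1\<bar> < 21 \<longrightarrow> \<bar>y$2 - q$2\<bar> < 21 \<longrightarrow> y$3 < (k + 3) * sqrt (2/3)"
  obtains Z where "finite Z" "card Y < card Z"
    "\<And>x y. x \<in> Z \<Longrightarrow> y \<in> Z \<Longrightarrow> x \<noteq> y \<Longrightarrow> norm (x - y) \<ge> 1"
    "\<And>z. z \<in> Z \<Longrightarrow> z \<in> Y \<or> (\<bar>z$1 - q$1\<bar> \<le> 20 \<and> \<bar>z$2 - q$2\<bar> \<le> 20 \<and>
       k * sqrt (2/3) + 1 \<le> z$3 \<and> z$3 \<le> k * sqrt (2/3) + 1 + sqrt 2)"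
proof -
  obtain \<sigma> where \<sigma>: "H = layer_stack \<sigma>"
    using H unfolding hexagonal_close_configuration_def by auto
  define h where "h = sqrt (2/3 :: real)"
  have h: "h > 0" by (simp add: h_def)
  \<comment> \<open>The points to be removed. By \<open>top\<close> they lie in layers
    \<open>k + 1\<close> and \<open>k + 2\<close>, hence number at most
    \<open>2 * 2058 = 4116\<close>.\<close>
  define R where "R = {y \<in> Y. \<bar>y$1 - q$1\<bar> < 21 \<and> \<bar>y$2 - q$2\<bar> < 21 \<and> y$3 > k * h}"
  define hbox where "hbox l = {y. (\<exists>m n. y = hex_point (\<sigma> l) l m n) \<and> \<bar>y$1 - q$1\<bar> < 21 \<and> \<bar>y$2 - q$2\<bar> < 21}" for l
  have hbox: "finite (hbox l)" "card (hbox l) \<le> 2058" for l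
    unfolding hbox_def by (rule card_hex_layer_box)+
  have "R \<subseteq> hbox (k + 1) \<union> hbox (k + 2)"
  proof
    fix y assume "y \<in> R"
    then have y: "y \<in> Y" "\<bar>y$1 - q$1\<bar> < 21" "\<bar>y$2 - q$2\<bar> < 21" "y$3 > k * h" unfolding R_def by auto
    obtain l m n where l: "y = hex_point (\<sigma> l) l m n" using y(1) Y(2) \<sigma> layer_stack_iff by blast
    have "y$3 < (k + 3) * sqrt (2/3)" using top y(1-3) by blast
    then have "l * h < (k + 3) * h" "k * h < l * h" using y(4) l by (simp_all add: h_def)
    then have "l < k + 3" "k < l" using h by (simp_all add: mult_less_cancel_right)
    then have "l = k + 1 \<or> l = k + 2" by linarith
    then show "y \<in> hbox (k + 1) \<union> hbox (k + 2)" using l y unfolding hbox_def by blast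
  qed
  then have "card R \<le> card (hbox (k + 1) \<union> hbox (k + 2))" by (intro card_mono finite_UnI hbox)
  also have "\<dots> \<le> 4116" using card_Un_le[of "hbox (k + 1)" "hbox (k + 2)"] hbox(2)[of "k + 1"] hbox(2)[of "k + 2"] by linarith
  finally have cR: "card R \<le> 4116" .
  \<comment> \<open>The new points number \<open>40 * 40 * 3 = 4800\<close>. They stay within
    \<open>20\<close> of \<open>q\<close> in both horizontal coordinates, a margin of
    \<open>1\<close> inside the cleared box.\<close>
  define P where "P = {0..39::int} \<times> {0..39::int} \<times> {0..2::int}"
  define S where "S = square_point q (k * h) ` P"
  have sep: "norm (square_point q (k * h) p - square_point q (k * h) p') \<ge> 1" if "p \<in> P" "p' \<in> P" "p \<noteq> p'" for p p'
    using that by (intro square_point_separated) (auto simp: P_def)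
  have "inj_on (square_point q (k * h)) P"
    using sep by (intro inj_onI) (metis diff_self norm_zero not_one_le_zero)
  then have cS: "card S = 4800" "finite S"
    unfolding S_def by (simp_all add: card_image P_def card_cartesian_product)
  have S: "\<bar>z$1 - q$1\<bar> \<le> 20" "\<bar>z$2 - q$2\<bar> \<le> 20" "k * h + 1 \<le> z$3" "z$3 \<le> k * h + 1 + sqrt 2"
    if "z \<in> S" for z
  proof -
    obtain i j a where p: "z = square_point q (k * h) (i, j, a)" "0 \<le> i" "i \<le> 39" "0 \<le> j" "j \<le> 39" "0 \<le> a" "a \<le> 2"
      using \<open>z \<in> S\<close> unfolding S_def P_def by auto
    show "\<bar>z$1 - q$1\<bar> \<le> 20" "\<bar>z$2 - q$2\<bar> \<le> 20"
      using p by (auto simp: square_point_def Let_def)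
    have "a * sqrt (1/2) \<le> 2 * sqrt (1/2)" using p by (intro mult_right_mono) simp_all
    also have "2 * sqrt (1/2) = sqrt (2::real)"
      by (rule real_sqrt_unique[symmetric]) (simp_all add: power_mult_distrib)
    finally show "z$3 \<le> k * h + 1 + sqrt 2" using p by (simp add: square_point_def Let_def)
    show "k * h + 1 \<le> z$3" using p by (simp add: square_point_def Let_def)
  qed
  \<comment> \<open>A kept point is either outside the box, so at least \<open>1\<close> away in a
    horizontal coordinate, or at height at most \<open>k * h\<close>, so at least \<open>1\<close>
    below every new point.\<close>
  have cross: "norm (z - y) \<ge> 1" if z: "z \<in> S" and y: "y \<in> Y - R" for z y
  proof -
    have "\<bar>(z - y)$1\<bar> \<ge> 1 \<or> \<bar>(z - y)$2\<bar> \<ge> 1 \<or> \<bar>(z - y)$3\<bar> \<ge> 1"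
      using S[OF z] y unfolding R_def by (simp add: abs_le_iff abs_less_iff) linarith
    then show ?thesis using component_le_norm_cart[of "z - y"] by (meson order_trans)
  qed
  have cross': "norm (y - z) \<ge> 1" if "z \<in> S" "y \<in> Y - R" for z y
    using cross[OF that] by (simp add: norm_minus_commute)
  have disj: "(Y - R) \<inter> S = {}" using cross by fastforce
  show thesis
  proof (rule that)
    show "finite ((Y - R) \<union> S)" using Y(1) cS(2) by simp
    have RY: "R \<subseteq> Y" unfolding R_def by blast
    have "card ((Y - R) \<union> S) = card (Y - R) + card S"
      using disj Y(1) cS(2) by (simp add: card_Un_disjoint)
    moreover have "card (Y - R) = card Y - card R" using RY Y(1) by (simp add: card_Diff_subset finite_subset)
    ultimately show "card Y < card ((Y - R) \<union> S)" using cR cS(1) by linarith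
    fix x y assume xy: "x \<in> (Y - R) \<union> S" "y \<in> (Y - R) \<union> S" "x \<noteq> y"
    show "norm (x - y) \<ge> 1"
      using xy cross cross' hexagonal_close_configuration_separated[OF H] Y(2) sep
      unfolding S_def by blast
  next
    fix z assume "z \<in> (Y - R) \<union> S"
    then show "z \<in> Y \<or> (\<bar>z$1 - q$1\<bar> \<le> 20 \<and> \<bar>z$2 - q$2\<bar> \<le> 20 \<and>
       k * sqrt (2/3) + 1 \<le> z$3 \<and> z$3 \<le> k * sqrt (2/3) + 1 + sqrt 2)"
      using S[of z] unfolding h_def by blast
  qed
qed

section \<open>Packings in a smooth convex body\<close>

text \<open>Distances between points of \<open>X\<close> alone must determine a motion of the whole
  space, since whole balls are to be moved. The map is linear on the span of the differences; the
  orthogonal complements of that span and of its image have equal dimension, so an isometry between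
  them completes it.\<close>

lemma isometry_on_extends:
  fixes f :: "'a::euclidean_space \<Rightarrow> 'a"
  assumes iso: "\<And>x y. x \<in> X \<Longrightarrow> y \<in> X \<Longrightarrow> dist (f x) (f y) = dist x y"
  obtains T c where "orthogonal_transformation T" "\<And>x. x \<in> X \<Longrightarrow> f x = c + T x"
proof (cases "X = {}")
  case True
  then show ?thesis using that[of "\<lambda>x. x" 0] by simp
next
  case False
  then obtain x0 where x0: "x0 \<in> X" by blast
  define V where "V = (\<lambda>x. x - x0) ` X"
  define \<phi> where "\<phi> v = f (x0 + v) - f x0" for v
  have inX: "x0 + v \<in> X" if "v \<in> V" for v using that unfolding V_def by auto
  have \<phi>n: "norm (\<phi> v) = norm v" if "v \<in> V" for v
    using iso[OF inX[OF that] x0] by (simp add: \<phi>_def dist_norm)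
  have \<phi>d: "norm (\<phi> v - \<phi> w) = norm (v - w)" if "v \<in> V" "w \<in> V" for v w
    using iso[OF inX[OF that(1)] inX[OF that(2)]] by (simp add: \<phi>_def dist_norm)
  have \<phi>i: "\<phi> v \<bullet> \<phi> w = v \<bullet> w" if "v \<in> V" "w \<in> V" for v w
    by (simp add: dot_norm_neg \<phi>n \<phi>d that)
  obtain B where B: "B \<subseteq> V" "independent B" "V \<subseteq> span B"
    by (metis basis_exists)
  obtain L where L: "linear L" "\<And>b. b \<in> B \<Longrightarrow> L b = \<phi> b"
    using linear_independent_extend[OF B(2), of \<phi>] by blast
  define S where "S = span B"
  interpret L: linear L by fact
  have \<phi>L: "\<phi> v \<bullet> L x = v \<bullet> x" if "v \<in> V" "x \<in> S" for v x
    using that(2) unfolding S_def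
  proof (induction rule: span_induct_alt)
    case base then show ?case by (simp add: L.zero)
  next
    case (step c b y)
    then show ?case using \<phi>i[OF that(1)] B(1) L(2)
      by (auto simp: L.add L.scale inner_add_right subset_iff)
  qed
  have LL: "L x \<bullet> L y = x \<bullet> y" if "x \<in> S" "y \<in> S" for x y
    using that(1) unfolding S_def
  proof (induction rule: span_induct_alt)
    case base then show ?case by (simp add: L.zero)
  next
    case (step c b z)
    then show ?case using \<phi>L[OF _ that(2)] B(1) L(2)
      by (auto simp: L.add L.scale inner_add_left subset_iff)
  qed
  \<comment> \<open>\<open>L\<close> was prescribed on the basis \<open>B\<close> only. On the rest
    of \<open>V\<close> the agreement follows because all scalar products involved coincide.\<close>
  have Lv: "L v = \<phi> v" if "v \<in> V" for v
  proof -
    have vS: "v \<in> S" using that B(3) unfolding S_def by blast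
    have "(L v - \<phi> v) \<bullet> (L v - \<phi> v) = 0"
      using LL[OF vS vS] \<phi>L[OF that vS] \<phi>i[OF that that]
      by (simp add: inner_diff_left inner_diff_right inner_commute)
    then show ?thesis by simp
  qed
  have subS: "subspace S" by (simp add: S_def)
  have subLS: "subspace (L ` S)" using L.linear_axioms subS by (simp add: linear_subspace_image)
  have "inj_on L S"
  proof (rule inj_onI)
    fix x y assume xy: "x \<in> S" "y \<in> S" "L x = L y"
    have "x - y \<in> S" using xy subS by (simp add: subspace_diff)
    then have "(x - y) \<bullet> (x - y) = 0" using LL[of "x - y" "x - y"] xy(3) by (simp add: L.diff)
    then show "x = y" by simp
  qed
  then have dimeq: "dim (L ` S) = dim S"
    using dim_image_eq[OF L(1), of S] by (simp add: span_eq_iff[THEN iffD2, OF subS])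
  define S' where "S' = {y \<in> UNIV. \<forall>x \<in> S. orthogonal x y}"
  define R' where "R' = {y \<in> UNIV. \<forall>x \<in> L ` S. orthogonal x y}"
  have "dim S' + dim S = dim (UNIV :: 'a set)" "dim R' + dim (L ` S) = dim (UNIV :: 'a set)"
    unfolding S'_def R'_def
    by (rule dim_subspace_orthogonal_to_vectors; use subS subLS in simp)+
  then have dd: "dim S' = dim R'" using dimeq by linarith
  have sub': "subspace S'" "subspace R'"
    unfolding S'_def R'_def subspace_def orthogonal_def by (auto simp: inner_add_right)
  obtain G where G: "linear G" "G ` S' = R'" "\<And>x. x \<in> S' \<Longrightarrow> norm (G x) = norm x"
    using isometry_subspaces[OF sub' dd] by metis
  have "\<exists>y\<in>S. x - y \<in> S'" for x
  proof -
    obtain y z where "y \<in> span S" "\<And>w. w \<in> span S \<Longrightarrow> orthogonal z w" "x = y + z"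
      using orthogonal_subspace_decomp_exists by metis
    then show ?thesis
      by (intro bexI[of _ y])
        (auto simp: S'_def orthogonal_commute span_base span_eq_iff[THEN iffD2, OF subS])
  qed
  then obtain P where P: "\<And>x. P x \<in> S" "\<And>x. x - P x \<in> S'" by metis
  \<comment> \<open>\<open>P\<close> is the orthogonal projection onto \<open>S\<close>;
    \<open>L\<close> acts on \<open>S\<close> and \<open>G\<close> on its complement, with
    orthogonal images.\<close>
  define T where "T x = L (P x) + G (x - P x)" for x
  have sum: "norm (L a + G b) = norm (a + b)" if "a \<in> S" "b \<in> S'" for a b
  proof -
    have "orthogonal (L a) (G b)" using G(2) that unfolding R'_def by blast
    moreover have "orthogonal a b" using that unfolding S'_def by blast
    moreover have "norm (L a) = norm a" using LL[OF that(1) that(1)] by (simp add: norm_eq_sqrt_inner)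
    ultimately have "(norm (L a + G b))\<^sup>2 = (norm (a + b))\<^sup>2"
      using G(3)[OF that(2)] by (simp add: norm_add_Pythagorean)
    then show ?thesis by simp
  qed
  have "dist (T x) (T y) = dist x y" for x y
  proof -
    have "T x - T y = L (P x - P y) + G ((x - P x) - (y - P y))"
      by (simp add: T_def L.diff linear_diff[OF G(1)])
    then have "norm (T x - T y) = norm ((P x - P y) + ((x - P x) - (y - P y)))"
      using sum[of "P x - P y" "(x - P x) - (y - P y)"] P subS sub'(1)
      by (simp only: subspace_diff)
    then show ?thesis by (simp add: dist_norm)
  qed
  moreover have TS: "T x = L x" if "x \<in> S" for x
  proof -
    have "x - P x \<in> S" using that P(1) subS by (simp add: subspace_diff)
    then have "orthogonal (x - P x) (x - P x)" using P(2)[of x] unfolding S'_def by blast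
    then have "x = P x" by (simp add: orthogonal_self)
    then show ?thesis by (simp add: T_def linear_0[OF G(1)])
  qed
  moreover have "T 0 = 0" using TS[of 0] subS by (simp add: subspace_0 L.zero)
  ultimately have T: "orthogonal_transformation T"
    by (simp add: orthogonal_transformation_isometry)
  have "f x = (f x0 - T x0) + T x" if "x \<in> X" for x
  proof -
    have v: "x - x0 \<in> V" using that unfolding V_def by blast
    then have "x - x0 \<in> S" using B(3) unfolding S_def by blast
    then have "T (x - x0) = f x - f x0" using TS Lv[OF v] by (simp add: \<phi>_def)
    then show ?thesis using linear_diff[OF orthogonal_transformation_linear[OF T], of x x0]
      by (simp add: algebra_simps)
  qed
  with T show ?thesis by (rule that)
qed

section \<open>Local improvement near a high boundary point\<close>

lemma ball_arrangement_subset_iff: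
  "ball_arrangement r X \<subseteq> C \<longleftrightarrow> (\<forall>x\<in>X. \<forall>b. norm b \<le> 1 \<longrightarrow> x + r *\<^sub>R b \<in> C)"
proof -
  have "ball_arrangement r X = (\<Union>x\<in>X. (\<lambda>b. x + r *\<^sub>R b) ` cball 0 1)"
    unfolding ball_arrangement_def set_plus_def by blast
  then show ?thesis by (simp add: UN_subset_iff image_subset_iff Ball_def)
qed

lemma norm_le_sum_3: "norm (v :: real^3) \<le> \<bar>v$1\<bar> + \<bar>v$2\<bar> + \<bar>v$3\<bar>"
  using norm_le_l1_cart[of v] by (simp add: sum_3)

lemma sqrt_2_bounds: "sqrt (2::real) < 14143/10000"
  by (rule real_less_lsqrt) (simp_all add: power2_eq_square)

lemma sqrt_2_3_bounds: "8164/10000 < sqrt (2/3::real)" "sqrt (2/3::real) < 1"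
  by (rule real_less_rsqrt, simp add: power2_eq_square) simp

text \<open>The threshold \<open>r0\<close> must serve all orientations \<open>T\<close>,
  translations \<open>c\<close> and stackings at once; this is why flatness was proved uniformly in
  the direction.\<close>

lemma hex_packing_beaten:
  assumes C: "smooth_convex_body C"
  obtains r0 where "r0 > 0"
    "\<And>r T c H Y. 0 < r \<Longrightarrow> r < r0 \<Longrightarrow> orthogonal_transformation T \<Longrightarrow>
       hexagonal_close_configuration H \<Longrightarrow> finite Y \<Longrightarrow> Y \<subseteq> H \<Longrightarrow>
       ball_arrangement r ((\<lambda>y. c + (2 * r) *\<^sub>R T y) ` Y) \<subseteq> C \<Longrightarrow>
       \<exists>Z. card Y < card Z \<and> is_packing r Z \<and> ball_arrangement r Z \<subseteq> C"
proof -
  have cpt: "compact C" "convex C" "interior C \<noteq> {}"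
    using C unfolding smooth_convex_body_def convex_body_def by auto
  obtain \<tau> where \<tau>: "\<tau> > 0"
    and below: "\<And>q u v. q \<in> C \<Longrightarrow> norm u = 1 \<Longrightarrow> (\<And>x. x \<in> C \<Longrightarrow> u \<bullet> x \<le> u \<bullet> q + \<tau>) \<Longrightarrow>
       norm v \<le> \<tau> \<Longrightarrow> u \<bullet> v \<le> - (1/10000) * norm v \<Longrightarrow> q + v \<in> C"
    and above: "\<And>q u v. q \<in> frontier C \<Longrightarrow> norm u = 1 \<Longrightarrow> (\<And>x. x \<in> C \<Longrightarrow> u \<bullet> x \<le> u \<bullet> q + \<tau>) \<Longrightarrow>
       q + v \<in> C \<Longrightarrow> u \<bullet> v \<le> (1/10000) * norm v"
    \<comment> \<open>Within about \<open>43\<close> ball diameters this slope allows an error below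
      \<open>1/200\<close> of a diameter, less than the slack on either side of
      \<open>2.43\<close>.\<close>
    using smooth_cap_flat[OF C, of "1/10000"] by (metis divide_pos_pos zero_less_numeral zero_less_one)
  obtain p where "p \<in> interior C" using cpt(3) by auto
  then obtain \<rho> where \<rho>: "\<rho> > 0" "cball p \<rho> \<subseteq> C" by (auto simp: mem_interior_cball)
  define h where "h = sqrt (2/3 :: real)"
  have h: "8164/10000 < h" "h < 1" unfolding h_def by (rule sqrt_2_3_bounds)+
  show thesis
  proof (rule that)
    \<comment> \<open>The factor \<open>100\<close> yields \<open>2 * r * 43 \<le> \<tau>\<close>
      for the box and makes one layer distance \<open>2 * r * h\<close> smaller than both
      \<open>\<tau>\<close> and \<open>\<rho>\<close>.\<close>
    show "min \<tau> \<rho> / 100 > 0" using \<tau> \<rho> by simp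
    fix r :: real and T and c :: "real^3" and H Y
    assume r: "0 < r" "r < min \<tau> \<rho> / 100" and T: "orthogonal_transformation T"
      and H: "hexagonal_close_configuration H" and Y: "finite Y" "Y \<subseteq> H"
      and ball: "ball_arrangement r ((\<lambda>y. c + (2 * r) *\<^sub>R T y) ` Y) \<subseteq> C"
    have lin: "linear T" using T by (rule orthogonal_transformation_linear)
    have Ti: "T v \<bullet> T w = v \<bullet> w" and Tn: "norm (T v) = norm v" for v w
      using T orthogonal_transformation_norm by (auto simp: orthogonal_transformation_def)
    have Ts: "surj T" using T by (rule orthogonal_transformation_surj)
    define e3 :: "real^3" where "e3 = axis 3 1"
    define u where "u = T e3"
    have ne3: "norm e3 = 1" unfolding e3_def by (simp add: norm_axis_1)
    have u1: "norm u = 1" by (simp add: u_def Tn ne3)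
    have uT: "u \<bullet> T v = v$3" for v by (simp add: u_def Ti e3_def inner_axis')
    have "p \<in> C" using \<rho>(1) by (intro subsetD[OF \<rho>(2)]) simp
    then have "C \<noteq> {}" by blast
    moreover have "continuous_on C ((\<bullet>) u)" by (intro continuous_intros)
    ultimately obtain b where b': "b \<in> C" "\<forall>x\<in>C. u \<bullet> x \<le> u \<bullet> b"
      using continuous_attains_sup[OF cpt(1)] by metis
    then have b: "b \<in> C" "\<And>x. x \<in> C \<Longrightarrow> u \<bullet> x \<le> u \<bullet> b" by simp_all
    have low: "p - \<rho> *\<^sub>R u \<in> C" using \<rho> u1 by (intro subsetD[OF \<rho>(2)]) (simp add: dist_norm)
    have "u \<bullet> u = 1" using u1 by (simp add: norm_eq_1)
    then have low': "u \<bullet> (p - \<rho> *\<^sub>R u) \<le> u \<bullet> b - \<rho>"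
      using b(2)[OF \<open>p \<in> C\<close>] by (simp add: inner_diff_right)
    \<comment> \<open>\<open>293/100\<close> is \<open>2.43\<close> plus the ball radius
      \<open>1/2\<close>. \<open>k\<close> is the last layer for which this height above it does not
      exceed the top of \<open>C\<close>, so \<open>t\<close> lies less than one layer distance
      below the top.\<close>
    define k where "k = \<lfloor>((u \<bullet> b - u \<bullet> c) / (2 * r) - 293/100) / h\<rfloor>"
    define t where "t = u \<bullet> c + 2 * r * (k * h + 293/100)"
    have kl: "k * h \<le> (u \<bullet> b - u \<bullet> c) / (2 * r) - 293/100"
    proof -
      have "k \<le> ((u \<bullet> b - u \<bullet> c) / (2 * r) - 293/100) / h" unfolding k_def by linarith
      then show ?thesis using h by (simp add: pos_le_divide_eq)
    qed
    have ku: "(u \<bullet> b - u \<bullet> c) / (2 * r) - 293/100 < k * h + h"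
    proof -
      have "((u \<bullet> b - u \<bullet> c) / (2 * r) - 293/100) / h < k + 1" unfolding k_def by linarith
      then show ?thesis using h by (simp add: pos_divide_less_eq algebra_simps)
    qed
    have t1: "t \<le> u \<bullet> b" using kl r unfolding t_def by (simp add: field_simps)
    have t2: "t > u \<bullet> b - 2 * r * h" using ku r unfolding t_def by (simp add: field_simps)
    have "2 * r * h \<le> 2 * r * 1" using h r by (intro mult_left_mono) simp_all
    then have t3: "t \<ge> u \<bullet> b - \<tau>" "t \<ge> u \<bullet> b - \<rho>" using t2 r by linarith+
    have "u \<bullet> (p - \<rho> *\<^sub>R u) \<le> t" using low' t3 by linarith
    then obtain q0 where q0: "q0 \<in> frontier C" "u \<bullet> q0 = t"
      using frontier_point_at_height[OF cpt(1,2) low b(1) _ t1] by metis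
    have q0C: "q0 \<in> C" using q0 cpt(1) by (simp add: frontier_def compact_imp_closed)
    have cap: "u \<bullet> x \<le> u \<bullet> q0 + \<tau>" if "x \<in> C" for x using b(2)[OF that] t3 q0 by linarith
    \<comment> \<open>\<open>q\<close> is the boundary point \<open>q0\<close> in the coordinates of
      \<open>H\<close>, where balls have radius \<open>1/2\<close>.\<close>
    obtain q where q: "T q = (1 / (2 * r)) *\<^sub>R (q0 - c)" using Ts by (metis surjD)
    have q0': "q0 = c + (2 * r) *\<^sub>R T q" using q r by simp
    have q3: "q$3 = k * h + 293/100"
    proof -
      have "u \<bullet> q0 = u \<bullet> c + 2 * r * q$3" by (subst q0') (simp add: inner_add_right uT)
      then have "2 * r * q$3 = 2 * r * (k * h + 293/100)" using q0(2) unfolding t_def by linarith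
      then show ?thesis using r by simp
    qed
    have shift: "c + (2 * r) *\<^sub>R T (q + v) = q0 + (2 * r) *\<^sub>R T v" for v
      by (simp add: q0' linear_add[OF lin] algebra_simps)
    have ab: "v$3 \<le> (1/10000) * norm v" if "c + (2 * r) *\<^sub>R T (q + v) \<in> C" for v
    proof -
      have "u \<bullet> ((2 * r) *\<^sub>R T v) \<le> (1/10000) * norm ((2 * r) *\<^sub>R T v)"
        by (rule above[OF q0(1) u1 cap]) (use that shift in simp_all)
      then have "2 * r * v$3 \<le> 2 * r * ((1/10000) * norm v)" using r by (simp add: uT Tn)
      then show ?thesis using r by (simp only: mult_le_cancel_left_pos)
    qed
    have be: "c + (2 * r) *\<^sub>R T (q + v) \<in> C" if "norm v \<le> 43" "v$3 \<le> - (1/10000) * norm v" for v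
    proof -
      have "2 * r * v$3 \<le> 2 * r * (- (1/10000) * norm v)" using r that by (intro mult_left_mono) simp_all
      then have 1: "u \<bullet> ((2 * r) *\<^sub>R T v) \<le> - (1/10000) * norm ((2 * r) *\<^sub>R T v)" using r by (simp add: uT Tn)
      have "2 * r * norm v \<le> 2 * r * 43" using r that by (intro mult_left_mono) simp_all
      also have "\<dots> \<le> \<tau>" using r by simp
      finally have "norm ((2 * r) *\<^sub>R T v) \<le> \<tau>" using r by (simp add: Tn)
      from below[OF q0C u1 cap this 1] show ?thesis unfolding shift by simp
    qed
    have top: "\<forall>y\<in>Y. \<bar>y$1 - q$1\<bar> < 21 \<longrightarrow> \<bar>y$2 - q$2\<bar> < 21 \<longrightarrow> y$3 < (k + 3) * sqrt (2/3)"
    proof (intro ballI impI)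
      fix y assume y: "y \<in> Y" "\<bar>y$1 - q$1\<bar> < 21" "\<bar>y$2 - q$2\<bar> < 21"
      \<comment> \<open>The topmost point of the ball around \<open>y\<close>, seen from
        \<open>q\<close>; it lies in \<open>C\<close>, so it is hardly higher than
        \<open>q\<close>.\<close>
      define v where "v = (y - q) + (1/2) *\<^sub>R e3"
      have "c + (2 * r) *\<^sub>R T y + r *\<^sub>R u \<in> C"
        using ball y(1) u1 unfolding ball_arrangement_subset_iff by simp
      moreover have "c + (2 * r) *\<^sub>R T (q + v) = c + (2 * r) *\<^sub>R T y + r *\<^sub>R u"
        by (simp add: v_def u_def linear_add[OF lin] linear_diff[OF lin] linear_scale[OF lin] algebra_simps)
      ultimately have "v$3 \<le> (1/10000) * norm v" by (intro ab) (simp only:)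
      moreover have "norm v \<le> 42 + \<bar>v$3\<bar>"
        using norm_le_sum_3[of v] y(2,3) by (simp add: v_def e3_def axis_def)
      moreover have "v$3 = y$3 - q$3 + 1/2" by (simp add: v_def e3_def axis_def)
      \<comment> \<open>The \<open>0.01\<close> beyond \<open>2.43\<close> absorbs the flatness
        error, and \<open>3 * h\<close> still exceeds \<open>2.44\<close>.\<close>
      ultimately have "y$3 < k * h + 244/100" using q3 by linarith
      also have "\<dots> < k * h + 3 * h" using h by simp
      finally show "y$3 < (k + 3) * sqrt (2/3)" by (simp add: h_def algebra_simps)
    qed
    obtain Z where Z: "finite Z" "card Y < card Z"
      "\<And>x y. x \<in> Z \<Longrightarrow> y \<in> Z \<Longrightarrow> x \<noteq> y \<Longrightarrow> norm (x - y) \<ge> 1"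
      "\<And>z. z \<in> Z \<Longrightarrow> z \<in> Y \<or> (\<bar>z$1 - q$1\<bar> \<le> 20 \<and> \<bar>z$2 - q$2\<bar> \<le> 20 \<and>
       k * sqrt (2/3) + 1 \<le> z$3 \<and> z$3 \<le> k * sqrt (2/3) + 1 + sqrt 2)"
      using replace_two_hex_layers[OF H Y top] by metis
    define g where "g y = c + (2 * r) *\<^sub>R T y" for y
    have gd: "norm (g x - g y) = 2 * r * norm (x - y)" for x y
    proof -
      have "g x - g y = (2 * r) *\<^sub>R T (x - y)" by (simp add: g_def linear_diff[OF lin] algebra_simps)
      then show ?thesis using r by (simp add: Tn)
    qed
    have "inj_on g Z"
    proof (rule inj_onI)
      fix x y assume "g x = g y"
      then have "2 * r * norm (x - y) = 0" using gd[of x y] by simp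
      then show "x = y" using r by simp
    qed
    then have "card (g ` Z) = card Z" by (rule card_image)
    moreover have "is_packing r (g ` Z)"
      unfolding is_packing_def
    proof (intro ballI impI)
      fix x y assume "x \<in> g ` Z" "y \<in> g ` Z" "x \<noteq> y"
      then obtain x' y' where "x = g x'" "y = g y'" "x' \<in> Z" "y' \<in> Z" "x' \<noteq> y'" by blast
      then show "2 * r \<le> norm (x - y)" using Z(3)[of x' y'] r by (simp add: gd)
    qed
    moreover have "ball_arrangement r (g ` Z) \<subseteq> C"
      unfolding ball_arrangement_subset_iff
    proof (intro ballI allI impI)
      fix x b :: "real^3" assume x: "x \<in> g ` Z" and b: "norm b \<le> 1"
      then obtain z where z: "z \<in> Z" "x = g z" by blast
      show "x + r *\<^sub>R b \<in> C"
      proof (cases "z \<in> Y")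
        case True
        then show ?thesis using ball b z(2) unfolding ball_arrangement_subset_iff g_def by blast
      next
        case False
        with Z(4)[OF z(1)] have z': "\<bar>z$1 - q$1\<bar> \<le> 20" "\<bar>z$2 - q$2\<bar> \<le> 20"
          "k * h + 1 \<le> z$3" "z$3 \<le> k * h + 1 + sqrt 2" unfolding h_def by auto
        obtain b' where b': "T b' = b" using Ts by (metis surjD)
        then have nb: "norm b' \<le> 1" using b Tn by metis
        define v where "v = (z - q) + (1/2) *\<^sub>R b'"
        have "norm (z - q) \<le> 42"
          using norm_le_sum_3[of "z - q"] z' q3 sqrt_2_bounds by simp
        then have nv: "norm v \<le> 85/2"
          using norm_triangle_ineq[of "z - q" "(1/2) *\<^sub>R b'"] nb unfolding v_def by simp
        have "b'$3 \<le> 1" using component_le_norm_cart[of b' 3] nb by linarith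
        \<comment> \<open>The new balls end at height at most
          \<open>1 + sqrt 2 + 1/2 < 2.915\<close> above layer \<open>k\<close>, against
          \<open>2.93\<close> at \<open>q\<close>; flatness asks for a drop of only
          \<open>0.00425\<close>.\<close>
        then have "v$3 \<le> -15/1000" using z'(4) q3 sqrt_2_bounds unfolding v_def by simp
        then have "v$3 \<le> - (1/10000) * norm v" using nv by linarith
        then have "c + (2 * r) *\<^sub>R T (q + v) \<in> C" using nv by (intro be) simp_all
        moreover have "c + (2 * r) *\<^sub>R T (q + v) = x + r *\<^sub>R b"
          by (simp add: z(2) g_def v_def b' linear_add[OF lin] linear_diff[OF lin] linear_scale[OF lin] algebra_simps)
        ultimately show ?thesis by simp
      qed
    qed
    ultimately show "\<exists>Z. card Y < card Z \<and> is_packing r Z \<and> ball_arrangement r Z \<subseteq> C"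
      using Z(2) by metis
  qed
qed

section \<open>Rigid motions of close packings and comparison with the maximum\<close>

lemma fcc_packing_set_imp_hexagonal:
  assumes "fcc_packing_set r X" shows "hexagonal_close_packing_set r X"
proof -
  have "hexagonal_close_configuration fcc_lattice"
    unfolding hexagonal_close_configuration_def fcc_lattice_def by (rule exI[of _ "\<lambda>k. k"]) simp
  then show ?thesis
    using assms unfolding fcc_packing_set_def hexagonal_close_packing_set_def by blast
qed

text \<open>The inverse of the given isometry extends to a rigid motion, and the scaling by
  \<open>2 * r\<close> commutes with its linear part.\<close>

lemma hexagonal_close_packing_set_frame:
  assumes "hexagonal_close_packing_set r X"
  obtains H Y T c where "hexagonal_close_configuration H" "Y \<subseteq> H" "orthogonal_transformation T"
    "X = (\<lambda>y. c + (2 * r) *\<^sub>R T y) ` Y"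
proof -
  obtain H Y where H: "hexagonal_close_configuration H" and Y: "Y \<subseteq> (*\<^sub>R) (2 * r) ` H"
    and "isometric_sets X Y"
    using assms unfolding hexagonal_close_packing_set_def by metis
  then obtain f where f: "f ` X = Y" "\<And>x y. x \<in> X \<Longrightarrow> y \<in> X \<Longrightarrow> dist (f x) (f y) = dist x y"
    unfolding isometric_sets_def by metis
  have "inj_on f X" using f(2) by (intro inj_onI) (metis dist_eq_0_iff)
  then have inv: "\<And>x. x \<in> X \<Longrightarrow> inv_into X f (f x) = x" by simp
  obtain T c where T: "orthogonal_transformation T" "\<And>y. y \<in> Y \<Longrightarrow> inv_into X f y = c + T y"
  proof (rule isometry_on_extends[of Y "inv_into X f"])
    fix y y' assume "y \<in> Y" "y' \<in> Y"
    then show "dist (inv_into X f y) (inv_into X f y') = dist y y'"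
      using f inv by force
  qed blast
  have X: "X = (\<lambda>y. c + T y) ` Y"
  proof -
    have "X = inv_into X f ` Y" using inv by (force simp: f(1)[symmetric])
    also have "\<dots> = (\<lambda>y. c + T y) ` Y" using T(2) by (intro image_cong) auto
    finally show ?thesis .
  qed
  define Y0 where "Y0 = {y \<in> H. (2 * r) *\<^sub>R y \<in> Y}"
  have "Y = (*\<^sub>R) (2 * r) ` Y0" using Y unfolding Y0_def by blast
  then have "X = (\<lambda>y. c + (2 * r) *\<^sub>R T y) ` Y0"
    unfolding X by (simp add: image_image orthogonal_transformation_scaleR[OF T(1)])
  moreover have "Y0 \<subseteq> H" unfolding Y0_def by blast
  ultimately show thesis using that H T(1) by blast
qed

theorem corollary2:
  fixes C :: "(real^3) set"
  assumes "smooth_convex_body C"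
  shows "\<forall>\<epsilon>>0. \<exists>r. 0 < r \<and> r < \<epsilon> \<and>
    \<not> (\<exists>X. (fcc_packing_set r X \<or> hexagonal_close_packing_set r X) \<and>
          ball_arrangement r X \<subseteq> C \<and> card X = max_packing C r)"
proof (intro allI impI)
  fix \<epsilon> :: real assume \<epsilon>: "\<epsilon> > 0"
  have bC: "bounded C"
    using assms compact_imp_bounded unfolding smooth_convex_body_def convex_body_def by blast
  obtain r0 where r0: "r0 > 0"
    "\<And>r T c H Y. 0 < r \<Longrightarrow> r < r0 \<Longrightarrow> orthogonal_transformation T \<Longrightarrow>
       hexagonal_close_configuration H \<Longrightarrow> finite Y \<Longrightarrow> Y \<subseteq> H \<Longrightarrow>
       ball_arrangement r ((\<lambda>y. c + (2 * r) *\<^sub>R T y) ` Y) \<subseteq> C \<Longrightarrow>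
       \<exists>Z. card Y < card Z \<and> is_packing r Z \<and> ball_arrangement r Z \<subseteq> C"
    using hex_packing_beaten[OF assms] by metis
  define r where "r = min \<epsilon> r0 / 2"
  have r: "0 < r" "r < \<epsilon>" "r < r0" using \<epsilon> r0(1) by (auto simp: r_def)
  have False if X: "hexagonal_close_packing_set r X" "ball_arrangement r X \<subseteq> C"
      "card X = max_packing C r" for X
  proof -
    obtain H Y T c where H: "hexagonal_close_configuration H" and Y: "Y \<subseteq> H"
      and T: "orthogonal_transformation T" and XY: "X = (\<lambda>y. c + (2 * r) *\<^sub>R T y) ` Y"
      by (rule hexagonal_close_packing_set_frame[OF X(1)])
    have d: "norm ((c + (2 * r) *\<^sub>R T y) - (c + (2 * r) *\<^sub>R T z)) = 2 * r * norm (y - z)" for y z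
    proof -
      have "(c + (2 * r) *\<^sub>R T y) - (c + (2 * r) *\<^sub>R T z) = (2 * r) *\<^sub>R T (y - z)"
        by (simp add: linear_diff[OF orthogonal_transformation_linear[OF T]] algebra_simps)
      then show ?thesis using r by (simp add: orthogonal_transformation_norm[OF T])
    qed
    have inj: "inj_on (\<lambda>y. c + (2 * r) *\<^sub>R T y) Y"
    proof (rule inj_onI)
      fix y z assume eq: "c + (2 * r) *\<^sub>R T y = c + (2 * r) *\<^sub>R T z"
      have "2 * r * norm (y - z) = 0" unfolding d[symmetric] by (simp only: eq diff_self norm_zero)
      then show "y = z" using r by simp
    qed
    \<comment> \<open>Being a packing is not assumed of \<open>X\<close> but follows from the
      separation in \<open>H\<close>. It makes \<open>X\<close> finite, so \<open>card X\<close> is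
      not the default value \<open>0\<close> of an infinite set.\<close>
    have "is_packing r X"
      unfolding is_packing_def
    proof (intro ballI impI)
      fix x y assume "x \<in> X" "y \<in> X" "x \<noteq> y"
      then obtain x' y' where "x = c + (2 * r) *\<^sub>R T x'" "y = c + (2 * r) *\<^sub>R T y'"
        "x' \<in> Y" "y' \<in> Y" "x' \<noteq> y'" unfolding XY by (elim imageE) metis
      then show "2 * r \<le> norm (x - y)"
        using hexagonal_close_configuration_separated[OF H, of x' y'] Y r by (simp only: d) auto
    qed
    then have "finite X" using packing_card_bound[OF bC r(1)] X(2) by metis
    then have "finite Y" using inj XY finite_imageD by blast
    from r0(2)[OF r(1,3) T H this Y] X(2) XY
    obtain Z where Z: "card Y < card Z" "is_packing r Z" "ball_arrangement r Z \<subseteq> C" by blast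
    have "card Z \<in> packing_cards C r" using Z unfolding packing_cards_def by blast
    then have "card Z \<le> max_packing C r"
      unfolding max_packing_def using packing_cards_finite_nonempty(1)[OF bC r(1)] by simp
    moreover have "card X = card Y" unfolding XY by (rule card_image[OF inj])
    ultimately show False using X(3) Z(1) by simp
  qed
  then have "\<not> (\<exists>X. (fcc_packing_set r X \<or> hexagonal_close_packing_set r X) \<and>
          ball_arrangement r X \<subseteq> C \<and> card X = max_packing C r)"
    using fcc_packing_set_imp_hexagonal by blast
  then show "\<exists>r. 0 < r \<and> r < \<epsilon> \<and>
    \<not> (\<exists>X. (fcc_packing_set r X \<or> hexagonal_close_packing_set r X) \<and>
          ball_arrangement r X \<subseteq> C \<and> card X = max_packing C r)"
    using r by blast
qed

end
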